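(* Let $f_1,\dots,f_n:\mathbb{R}^d\to\mathbb{R}$ be differentiable and convex, with $f_i$ being $L_i$-smooth, $L_i>0$; let $f=\frac1n\sum_{i=1}^n f_i$ and $L_{\max}=\max_i L_i$. Suppose there is $x_\star\in\mathbb{R}^d$ with $\nabla f_i(x_\star)=0$ for all $i$ (interpolation regime). Let $\gamma>0$, $K\ge1$, and let $L_\gamma>0$ be the smoothness constant of $M^\gamma$. Consider full-participation FedExProx $x_{k+1}=x_k+\alpha_k\left(\frac1n\sum_{i=1}^n\mathrm{prox}_{\gamma f_i}(x_k)-x_k\right)$ started at $x_0\in\mathbb{R}^d$. (i) (FedExProx-GraDS) If $\alpha_k=\alpha_{k,G}$ where $$\alpha_{k,G}=\frac{\frac1n\sum_{i=1}^n\|x_k-\mathrm{prox}_{\gamma f_i}(x_k)\|^2}{\left\|\frac1n\sum_{i=1}^n(x_k-\mathrm{prox}_{\gamma f_i}(x_k))\right\|^2},$$ then $\alpha_{k,G}\ge1$ and $$\mathbb{E}[f(\bar x_K)]-\inf f\le\frac{1+\gamma L_{\max}}{2+\gamma L_{\max}}\cdot\left(\frac1\gamma+L_{\max}\right)\cdot\frac{\|x_0-x_\star\|^2}{\sum_{k=0}^{K-1}\alpha_{k,G}},$$ where $\bar x_K$ is chosen randomly from the first $K$ iterates $\{x_0,\dots,x_{K-1}\}$ with probabilities $p_k=\alpha_{k,G}/\sum_{j=0}^{K-1}\alpha_{j,G}$. (ii) (FedExProx-StoPS) If $\alpha_k=\alpha_{k,S}$ where $$\alpha_{k,S}=\frac{\frac1n\sum_{i=1}^n\left(M^\gamma_{f_i}(x_k)-\inf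 M^\gamma_{f_i}\right)}{\gamma\left\|\frac1n\sum_{i=1}^n\nabla M^\gamma_{f_i}(x_k)\right\|^2},$$ then $\alpha_{k,S}\ge\frac1{2\gamma L_\gamma}$ and $$\mathbb{E}[f(\bar x_K)]-\inf f\le\left(\frac1\gamma+L_{\max}\right)\cdot\frac{\|x_0-x_\star\|^2}{\sum_{k=0}^{K-1}\alpha_{k,S}},$$ where $\bar x_K$ is chosen randomly from the first $K$ iterates $\{x_0,\dots,x_{K-1}\}$ with probabilities $p_k=\alpha_{k,S}/\sum_{j=0}^{K-1}\alpha_{j,S}$.
   Context: $\|\cdot\|$ is the Euclidean norm. A differentiable $\phi:\mathbb{R}^d\to\mathbb{R}$ is $L$-smooth if $\phi(x)-\phi(y)-\langle\nabla\phi(y),x-y\rangle\le\frac L2\|x-y\|^2$ for all $x,y$. Proximity operator: $\mathrm{prox}_{\gamma\phi}(x)=\arg\min_{z}\{\phi(z)+\frac1{2\gamma}\|z-x\|^2\}$ (unique for proper closed convex $\phi$). Moreau envelope: $M^\gamma_\phi(x)=\min_z\{\phi(z)+\frac1{2\gamma}\|z-x\|^2\}$. $M^\gamma=\frac1n\sum_{i=1}^n M^\gamma_{f_i}$. The iterates are deterministic; the expectation is over the choice of $\bar x_K$. The denominators in the definitions of $\alpha_{k,G}$, $\alpha_{k,S}$ are assumed nonzero for $0\le k\le K-1$, so that these parameters are defined. *)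

theory Defs
  imports "HOL-Analysis.Analysis" "HOL-Probability.Probability"
begin

text \<open>The gradient is a definite description; it is meaningful only at points of
  differentiability, where it is the unique Riesz representative of the derivative.\<close>

definition gradient :: "('a::real_inner \<Rightarrow> real) \<Rightarrow> 'a \<Rightarrow> 'a"
  where "gradient \<phi> x = (THE D. GDERIV \<phi> x :> D)"

definition L_smooth :: "real \<Rightarrow> ('a::real_inner \<Rightarrow> real) \<Rightarrow> bool"
  where "L_smooth L \<phi> \<longleftrightarrow>
    (\<forall>x. \<phi> differentiable (at x)) \<and>
    (\<forall>x y. \<phi> x - \<phi> y - inner (gradient \<phi> y) (x - y) \<le> L / 2 * (norm (x - y))\<^sup>2)"

definition prox :: "real \<Rightarrow> ('a::real_inner \<Rightarrow> real) \<Rightarrow> 'a \<Rightarrow> 'a"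
  where "prox \<gamma> \<phi> x = arg_min (\<lambda>z. \<phi> z + 1 / (2 * \<gamma>) * (norm (z - x))\<^sup>2) (\<lambda>_. True)"

text \<open>For convex \<open>\<phi>\<close> on a Euclidean space and \<open>\<gamma> > 0\<close> the infimum below is attained
  (at \<open>prox \<gamma> \<phi> x\<close>), so it is the minimum.\<close>

definition moreau_env :: "real \<Rightarrow> ('a::real_inner \<Rightarrow> real) \<Rightarrow> 'a \<Rightarrow> real"
  where "moreau_env \<gamma> \<phi> x = (INF z. \<phi> z + 1 / (2 * \<gamma>) * (norm (z - x))\<^sup>2)"

definition avg :: "nat \<Rightarrow> (nat \<Rightarrow> 'b::real_vector) \<Rightarrow> 'b"
  where "avg n v = (1 / real n) *\<^sub>R (\<Sum>i=1..n. v i)"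

definition alpha_GraDS :: "nat \<Rightarrow> real \<Rightarrow> (nat \<Rightarrow> 'a::real_inner \<Rightarrow> real) \<Rightarrow> 'a \<Rightarrow> real"
  where "alpha_GraDS n \<gamma> f x =
    avg n (\<lambda>i. (norm (x - prox \<gamma> (f i) x))\<^sup>2) / (norm (avg n (\<lambda>i. x - prox \<gamma> (f i) x)))\<^sup>2"

definition alpha_StoPS :: "nat \<Rightarrow> real \<Rightarrow> (nat \<Rightarrow> 'a::real_inner \<Rightarrow> real) \<Rightarrow> 'a \<Rightarrow> real"
  where "alpha_StoPS n \<gamma> f x =
    avg n (\<lambda>i. moreau_env \<gamma> (f i) x - (INF y. moreau_env \<gamma> (f i) y)) /
      (\<gamma> * (norm (avg n (\<lambda>i. gradient (moreau_env \<gamma> (f i)) x)))\<^sup>2)"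

text \<open>The law of the random output: \<open>x k\<close> is drawn with probability
  \<open>a k / (\<Sum>j<K. a j)\<close>, \<open>k < K\<close>. As always with \<open>embed_pmf\<close>, this is meaningful only if
  these weights form a probability vector, e.g. if \<open>K \<ge> 1\<close> and \<open>a k > 0\<close> for \<open>k < K\<close>.\<close>

definition random_iterate :: "(nat \<Rightarrow> 'a) \<Rightarrow> (nat \<Rightarrow> real) \<Rightarrow> nat \<Rightarrow> 'a pmf"
  where "random_iterate x a K =
    map_pmf x (embed_pmf (\<lambda>k. if k < K then a k / (\<Sum>j<K. a j) else 0))"

lemma expectation_random_iterate:
  fixes g :: "'a \<Rightarrow> real"
  assumes "K \<ge> 1" and pos: "\<And>k. k < K \<Longrightarrow> a k > 0"
  shows "measure_pmf.expectation (random_iterate x a K) g =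
    (\<Sum>k<K. a k / (\<Sum>j<K. a j) * g (x k))"
proof -
  let ?w = "\<lambda>k. if k < K then a k / (\<Sum>j<K. a j) else 0"
  have S: "(\<Sum>j<K. a j) > 0"
    using assms by (intro sum_pos) (auto simp: lessThan_empty_iff)
  have nonneg: "?w k \<ge> 0" for k
    using S pos[of k] by (auto intro: less_imp_le)
  have "(\<integral>\<^sup>+k. ennreal (?w k) \<partial>count_space UNIV) =
      (\<integral>\<^sup>+k. ennreal (?w k) \<partial>count_space {..<K})"
    by (rule nn_integral_count_space_eq) auto
  also have "\<dots> = (\<Sum>k<K. ennreal (?w k))"
    by (simp add: nn_integral_count_space_finite)
  also have "\<dots> = ennreal (\<Sum>k<K. ?w k)"
    by (rule sum_ennreal) (rule nonneg)
  also have "(\<Sum>k<K. ?w k) = 1"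
    using S by (simp add: sum_divide_distrib[symmetric])
  finally have int: "(\<integral>\<^sup>+k. ennreal (?w k) \<partial>count_space UNIV) = 1"
    by simp
  have w: "pmf (embed_pmf ?w) k = ?w k" for k
    using nonneg int by (rule pmf_embed_pmf)
  have "measure_pmf.expectation (random_iterate x a K) g =
      measure_pmf.expectation (embed_pmf ?w) (\<lambda>k. g (x k))"
    by (simp add: random_iterate_def)
  also have "\<dots> = (\<Sum>k<K. g (x k) * pmf (embed_pmf ?w) k)"
    by (rule integral_measure_pmf_real) (auto simp: set_pmf_iff w split: if_splits)
  also have "\<dots> = (\<Sum>k<K. a k / (\<Sum>j<K. a j) * g (x k))"
    by (simp add: w mult.commute)
  finally show ?thesis .
qed

end

theory Submission
  imports Defs
begin

text \<open>Write \<open>u\<close> for the residual \<open>x - prox \<gamma> \<phi> x = \<gamma> \<nabla>\<phi>(prox \<gamma> \<phi> x)\<close>, which is also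
  \<open>\<gamma>\<close> times the gradient of the Moreau envelope. The subgradient inequality at the proximal point
  gives \<open>\<langle>u, x - x_star\<rangle> \<ge> \<parallel>u\<parallel>\<^sup>2 + \<gamma> \<Delta>\<close> with \<open>\<Delta> = \<phi>(prox \<gamma> \<phi> x) - min \<phi>\<close>, while smoothness gives
  \<open>\<parallel>u\<parallel>\<^sup>2 \<le> 2 L \<gamma>\<^sup>2 \<Delta>\<close> and bounds \<open>\<phi> x\<close> by \<open>\<phi>(prox \<gamma> \<phi> x) + (1/\<gamma> + L/2) \<parallel>u\<parallel>\<^sup>2\<close>. Together these bound
  the suboptimality of \<open>\<phi>\<close> at \<open>x\<close> by a multiple of \<open>2 \<langle>u, x - x_star\<rangle> - \<parallel>u\<parallel>\<^sup>2\<close>, respectively of the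
  suboptimality of the Moreau envelope. Either step size turns the average of the former quantity
  over \<open>i\<close>, respectively \<open>\<gamma>\<close> times the average of the latter, into a lower bound of
  \<open>(\<parallel>x k - x_star\<parallel>\<^sup>2 - \<parallel>x (k+1) - x_star\<parallel>\<^sup>2) / \<alpha> k\<close>, and the sum over \<open>k\<close> telescopes.\<close>

section \<open>Gradients\<close>

lemma gradient_eqI:
  assumes "GDERIV \<phi> x :> D"
  shows "gradient \<phi> x = D"
  unfolding gradient_def
proof (rule the_equality)
  fix E assume "GDERIV \<phi> x :> E"
  with assms have "(\<lambda>h. inner h D) = (\<lambda>h. inner h E)"
    unfolding gderiv_def by (rule has_derivative_unique)
  then show "E = D"
    by (metis inner_commute vector_eq_rdot)
qed (rule assms)

text \<open>The adjoint of the derivative, applied to \<open>1\<close>, is its Riesz representative,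
  so a gradient exists wherever the derivative does.\<close>

lemma GDERIV_gradient:
  fixes \<phi> :: "'a::euclidean_space \<Rightarrow> real"
  assumes "\<phi> differentiable (at x)"
  shows "GDERIV \<phi> x :> gradient \<phi> x"
proof -
  obtain \<phi>' where d: "(\<phi> has_derivative \<phi>') (at x)"
    using assms by (auto simp: differentiable_def)
  then have "\<phi>' = (\<lambda>h. inner h (adjoint \<phi>' 1))"
    by (simp add: adjoint_works has_derivative_linear)
  with d have "GDERIV \<phi> x :> adjoint \<phi>' 1"
    by (simp add: gderiv_def)
  then show ?thesis
    using gradient_eqI by metis
qed

lemma GDERIV_avg:
  assumes "\<And>i. i \<in> {1..n} \<Longrightarrow> GDERIV (\<phi> i) x :> D i"
  shows "GDERIV (\<lambda>y. avg n (\<lambda>i. \<phi> i y)) x :> avg n D"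
proof -
  have "((\<lambda>y. (1 / real n) *\<^sub>R (\<Sum>i=1..n. \<phi> i y)) has_derivative
      (\<lambda>h. (1 / real n) *\<^sub>R (\<Sum>i=1..n. inner h (D i)))) (at x)"
    using assms by (intro has_derivative_scaleR_right has_derivative_sum) (auto simp: gderiv_def)
  then show ?thesis
    by (simp add: gderiv_def avg_def inner_sum_right)
qed

lemma GDERIV_norm_diff_power2:
  "GDERIV (\<lambda>z. c * (norm (z - x))\<^sup>2) y :> (2 * c) *\<^sub>R (y - x)"
  unfolding gderiv_def power2_norm_eq_inner
  by (auto intro!: derivative_eq_intros simp: inner_commute algebra_simps)

lemma GDERIV_minimum_eq_0:
  assumes "GDERIV \<phi> x :> D" "\<And>z. \<phi> x \<le> \<phi> z"
  shows "D = 0"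
proof -
  have "(\<lambda>h. inner h D) = (\<lambda>h. 0)"
    using assms unfolding gderiv_def by (intro has_derivative_local_min) auto
  then show ?thesis
    by (metis inner_eq_zero_iff)
qed

text \<open>Restriction to the line through \<open>x\<close> and \<open>z\<close> reduces this to
  the tangent inequality for convex functions of one real variable.\<close>

lemma convex_on_gradient_le:
  assumes "convex_on UNIV \<phi>" "GDERIV \<phi> x :> D"
  shows "\<phi> x + inner D (z - x) \<le> \<phi> z"
proof -
  define g where "g t = \<phi> (x + t *\<^sub>R (z - x))" for t :: real
  have "convex_on UNIV g"
  proof (rule convex_onI)
    fix t a b :: real assume t: "0 < t" "t < 1"
    have "x + ((1 - t) *\<^sub>R a + t *\<^sub>R b) *\<^sub>R (z - x) =
        (1 - t) *\<^sub>R (x + a *\<^sub>R (z - x)) + t *\<^sub>R (x + b *\<^sub>R (z - x))"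
      by (simp add: algebra_simps)
    with t show "g ((1 - t) *\<^sub>R a + t *\<^sub>R b) \<le> (1 - t) * g a + t * g b"
      unfolding g_def using convex_onD[OF assms(1), of t] by simp
  qed simp
  moreover have "(g has_real_derivative inner D (z - x)) (at 0 within UNIV)"
  proof -
    have "((\<lambda>t. x + t *\<^sub>R (z - x)) has_derivative (\<lambda>t. t *\<^sub>R (z - x))) (at 0)"
      by (auto intro!: derivative_eq_intros)
    moreover have "(\<phi> has_derivative (\<lambda>h. inner h D)) (at (x + 0 *\<^sub>R (z - x)))"
      using assms(2) by (simp add: gderiv_def)
    ultimately have "(g has_derivative (\<lambda>t. inner (t *\<^sub>R (z - x)) D)) (at 0)"
      unfolding g_def by (rule has_derivative_compose)
    then show ?thesis
      by (simp add: has_field_derivative_def inner_commute mult_commute_abs)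
  qed
  ultimately have "g 1 - g 0 \<ge> inner D (z - x) * (1 - 0)"
    by (intro convex_on_imp_above_tangent) auto
  then show ?thesis
    by (simp add: g_def)
qed

text \<open>Lets all \<open>f i\<close> share the constant \<open>Lmax\<close>, so that bounds on
  single functions have coefficients independent of \<open>i\<close> and can be averaged.\<close>

lemma L_smooth_mono:
  fixes \<phi> :: "'a::real_inner \<Rightarrow> real"
  assumes "L_smooth L \<phi>" "L \<le> L'"
  shows "L_smooth L' \<phi>"
  unfolding L_smooth_def
proof (intro conjI allI)
  fix x y :: 'a
  have "L / 2 * (norm (x - y))\<^sup>2 \<le> L' / 2 * (norm (x - y))\<^sup>2"
    using assms(2) by (intro mult_right_mono) auto
  with assms(1) show "\<phi> x - \<phi> y - inner (gradient \<phi> y) (x - y) \<le> L' / 2 * (norm (x - y))\<^sup>2"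
    unfolding L_smooth_def by (meson order_trans)
qed (use assms(1) in \<open>auto simp: L_smooth_def\<close>)

text \<open>Evaluate the smoothness inequality after a gradient step of length \<open>1 / L\<close>.\<close>

lemma L_smooth_gradient_bound:
  assumes "L_smooth L \<phi>" "L > 0" "\<And>z. m \<le> \<phi> z"
  shows "(norm (gradient \<phi> y))\<^sup>2 \<le> 2 * L * (\<phi> y - m)"
proof -
  let ?G = "gradient \<phi> y"
  let ?x = "y - (1 / L) *\<^sub>R ?G"
  have "\<phi> ?x - \<phi> y - inner ?G (?x - y) \<le> L / 2 * (norm (?x - y))\<^sup>2"
    using assms(1) unfolding L_smooth_def by blast
  moreover have "inner ?G (?x - y) = - (norm ?G)\<^sup>2 / L"
    by (simp add: dot_square_norm)
  moreover have "L / 2 * (norm (?x - y))\<^sup>2 = (norm ?G)\<^sup>2 / (2 * L)"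
    using assms(2) by (simp add: power_divide power2_eq_square field_simps)
  ultimately have "(norm ?G)\<^sup>2 / L - (norm ?G)\<^sup>2 / (2 * L) \<le> \<phi> y - m"
    using assms(3)[of ?x] by linarith
  then show ?thesis
    using assms(2) by (simp add: field_simps)
qed

section \<open>Proximity operator and Moreau envelope\<close>

locale smooth_convex_prox =
  fixes \<phi> :: "'a::euclidean_space \<Rightarrow> real" and L \<gamma> :: real and x_star :: 'a
  assumes gamma_pos: "\<gamma> > 0" and L_pos: "L > 0"
    and convex: "convex_on UNIV \<phi>" and smooth: "L_smooth L \<phi>"
    and gradient_star: "gradient \<phi> x_star = 0"
begin

section \<open>Existence and optimality condition of the proximal point\<close>

lemma GDERIV: "GDERIV \<phi> y :> gradient \<phi> y"
  using smooth by (intro GDERIV_gradient) (auto simp: L_smooth_def)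

lemma star_le: "\<phi> x_star \<le> \<phi> z"
  using convex_on_gradient_le[OF convex GDERIV, of x_star z] by (simp add: gradient_star)

text \<open>Since \<open>arg_min\<close> is a Hilbert choice, \<open>prox\<close> minimizes only
  once a minimizer is known to exist. Compactness gives one on a ball around \<open>x\<close>;
  outside that ball the objective is at least its value at the centre.\<close>

lemma prox_le:
  "\<phi> (prox \<gamma> \<phi> x) + 1 / (2 * \<gamma>) * (norm (prox \<gamma> \<phi> x - x))\<^sup>2
    \<le> \<phi> z + 1 / (2 * \<gamma>) * (norm (z - x))\<^sup>2"
proof -
  define h where "h z = \<phi> z + 1 / (2 * \<gamma>) * (norm (z - x))\<^sup>2" for z
  \<comment> \<open>At distance \<open>R\<close> the quadratic penalty equals
    \<open>\<phi> x - \<phi> x_star\<close>, the most that \<open>\<phi>\<close> can decrease from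
    \<open>x\<close>.\<close>
  define R where "R = sqrt (2 * \<gamma> * (\<phi> x - \<phi> x_star))"
  have "continuous_on UNIV \<phi>"
    using GDERIV by (auto intro!: continuous_at_imp_continuous_on has_derivative_continuous
        simp: gderiv_def)
  then have "continuous_on (cball x R) h"
    unfolding h_def by (intro continuous_intros) (rule continuous_on_subset, auto)
  moreover have "R \<ge> 0"
    using star_le[of x] gamma_pos by (simp add: R_def)
  ultimately obtain p where p: "\<And>z. z \<in> cball x R \<Longrightarrow> h p \<le> h z"
    using continuous_attains_inf[of "cball x R" h] by (metis cball_eq_empty compact_cball not_less)
  have "h p \<le> h z" for z
  proof (cases "z \<in> cball x R")
    case False
    then have "R\<^sup>2 \<le> (norm (z - x))\<^sup>2"
      using \<open>R \<ge> 0\<close> by (intro power_mono) (auto simp: dist_norm norm_minus_commute)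
    then have "\<phi> x - \<phi> x_star \<le> 1 / (2 * \<gamma>) * (norm (z - x))\<^sup>2"
      using star_le[of x] gamma_pos by (simp add: R_def field_simps)
    with star_le[of z] have "h x \<le> h z"
      by (simp add: h_def)
    with p[of x] \<open>R \<ge> 0\<close> show ?thesis
      by simp
  qed (rule p)
  then have "is_arg_min h (\<lambda>_. True) p"
    by (auto simp: is_arg_min_linorder)
  then have "is_arg_min h (\<lambda>_. True) (arg_min h (\<lambda>_. True))"
    unfolding arg_min_def by (rule someI)
  moreover have "arg_min h (\<lambda>_. True) = prox \<gamma> \<phi> x"
    by (simp only: prox_def h_def[abs_def])
  ultimately show ?thesis
    by (simp add: is_arg_min_linorder h_def)
qed

text \<open>First-order optimality at the minimizer of the proximal objective.\<close>

lemma gradient_prox: "gradient \<phi> (prox \<gamma> \<phi> x) = (1 / \<gamma>) *\<^sub>R (x - prox \<gamma> \<phi> x)"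
proof -
  let ?p = "prox \<gamma> \<phi> x"
  have "GDERIV (\<lambda>z. \<phi> z + 1 / (2 * \<gamma>) * (norm (z - x))\<^sup>2) ?p
      :> gradient \<phi> ?p + (2 * (1 / (2 * \<gamma>))) *\<^sub>R (?p - x)"
    by (intro GDERIV_add GDERIV GDERIV_norm_diff_power2)
  then have "gradient \<phi> ?p + (2 * (1 / (2 * \<gamma>))) *\<^sub>R (?p - x) = 0"
    by (rule GDERIV_minimum_eq_0) (rule prox_le)
  then show ?thesis
    by (simp add: algebra_simps add_eq_0_iff)
qed

lemma prox_subgradient:
  "\<phi> (prox \<gamma> \<phi> x) + inner (x - prox \<gamma> \<phi> x) (z - prox \<gamma> \<phi> x) / \<gamma> \<le> \<phi> z"
  using convex_on_gradient_le[OF convex GDERIV, of "prox \<gamma> \<phi> x" z] by (simp add: gradient_prox)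

section \<open>Value, infimum and gradient of the Moreau envelope\<close>

lemma moreau_env_bdd_below: "bdd_below (range (\<lambda>z. \<phi> z + 1 / (2 * \<gamma>) * (norm (z - x))\<^sup>2))"
  using prox_le by (intro bdd_belowI2)

lemma moreau_env_le: "moreau_env \<gamma> \<phi> x \<le> \<phi> z + 1 / (2 * \<gamma>) * (norm (z - x))\<^sup>2"
  unfolding moreau_env_def by (intro cINF_lower moreau_env_bdd_below) simp

lemma moreau_env_eq:
  "moreau_env \<gamma> \<phi> x = \<phi> (prox \<gamma> \<phi> x) + 1 / (2 * \<gamma>) * (norm (x - prox \<gamma> \<phi> x))\<^sup>2"
proof (rule antisym)
  show "moreau_env \<gamma> \<phi> x \<le> \<phi> (prox \<gamma> \<phi> x) + 1 / (2 * \<gamma>) * (norm (x - prox \<gamma> \<phi> x))\<^sup>2"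
    using moreau_env_le[of x "prox \<gamma> \<phi> x"] by (simp add: norm_minus_commute)
  show "\<phi> (prox \<gamma> \<phi> x) + 1 / (2 * \<gamma>) * (norm (x - prox \<gamma> \<phi> x))\<^sup>2 \<le> moreau_env \<gamma> \<phi> x"
    unfolding moreau_env_def using prox_le[of x]
    by (intro cINF_greatest) (auto simp: norm_minus_commute)
qed

lemma star_le_moreau_env: "\<phi> x_star \<le> moreau_env \<gamma> \<phi> y"
  using star_le[of "prox \<gamma> \<phi> y"] gamma_pos by (simp add: moreau_env_eq add_increasing2)

text \<open>The envelope never drops below the minimum of \<open>\<phi>\<close>, and it attains it
  at \<open>x_star\<close>, where \<open>z = x_star\<close> has no penalty.\<close>

lemma INF_moreau_env: "(INF y. moreau_env \<gamma> \<phi> y) = \<phi> x_star"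
proof (rule antisym)
  have "(INF y. moreau_env \<gamma> \<phi> y) \<le> moreau_env \<gamma> \<phi> x_star"
    using star_le_moreau_env by (intro cINF_lower bdd_belowI2) auto
  also have "\<dots> \<le> \<phi> x_star"
    using moreau_env_le[of x_star x_star] by simp
  finally show "(INF y. moreau_env \<gamma> \<phi> y) \<le> \<phi> x_star" .
  show "\<phi> x_star \<le> (INF y. moreau_env \<gamma> \<phi> y)"
    using star_le_moreau_env by (intro cINF_greatest) auto
qed

text \<open>The proximal point of \<open>x\<close> is a competitor in the infimum at
  \<open>y\<close>; expanding the square gives the remaining terms.\<close>

lemma moreau_env_upper:
  "moreau_env \<gamma> \<phi> y \<le> moreau_env \<gamma> \<phi> x + inner (x - prox \<gamma> \<phi> x) (y - x) / \<gamma>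
    + (norm (y - x))\<^sup>2 / (2 * \<gamma>)"
proof -
  let ?u = "x - prox \<gamma> \<phi> x"
  have "norm (prox \<gamma> \<phi> x - y) = norm (?u + (y - x))"
    by (simp add: norm_minus_commute)
  then have "(norm (prox \<gamma> \<phi> x - y))\<^sup>2 = (norm ?u)\<^sup>2 + 2 * inner ?u (y - x) + (norm (y - x))\<^sup>2"
    by (simp only: power2_norm_eq_inner inner_add_left inner_add_right inner_commute[of "y - x" ?u])
  then show ?thesis
    using moreau_env_le[of y "prox \<gamma> \<phi> x"] gamma_pos
    by (simp add: moreau_env_eq[of x] add_divide_distrib)
qed

text \<open>With \<open>q = prox \<gamma> \<phi> y\<close>, the subgradient inequality at \<open>prox \<gamma> \<phi> x\<close> leaves exactly the
  square \<open>(norm (y - q - (x - prox \<gamma> \<phi> x)))\<^sup>2 / (2 * \<gamma>)\<close>.\<close>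

lemma moreau_env_lower:
  "moreau_env \<gamma> \<phi> x + inner (x - prox \<gamma> \<phi> x) (y - x) / \<gamma> \<le> moreau_env \<gamma> \<phi> y"
proof -
  let ?u = "x - prox \<gamma> \<phi> x" and ?q = "prox \<gamma> \<phi> y"
  let ?v = "y - ?q"
  have "inner ?u (?q - prox \<gamma> \<phi> x) = inner ?u (y - x) + inner ?u ?u - inner ?u ?v"
    by (simp add: inner_diff_right)
  then have "\<phi> (prox \<gamma> \<phi> x) + (inner ?u (y - x) + inner ?u ?u - inner ?u ?v) / \<gamma> \<le> \<phi> ?q"
    using prox_subgradient[of x ?q] by simp
  \<comment> \<open>Young's inequality, from the square of \<open>?v - ?u\<close>.\<close>
  moreover have "inner ?u ?v / \<gamma> \<le> (inner ?u ?u + inner ?v ?v) / (2 * \<gamma>)"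
  proof -
    have "0 \<le> inner (?v - ?u) (?v - ?u)"
      by simp
    also have "\<dots> = inner ?v ?v - 2 * inner ?u ?v + inner ?u ?u"
      by (simp only: inner_diff_left[of ?v ?u] inner_diff_right[of _ ?v ?u] inner_commute[of ?v ?u])
    finally show ?thesis
      using gamma_pos by (simp add: divide_simps)
  qed
  moreover have "inner ?u ?u / \<gamma> = inner ?u ?u / (2 * \<gamma>) + inner ?u ?u / (2 * \<gamma>)"
    using gamma_pos by (simp add: field_simps)
  ultimately show ?thesis
    unfolding moreau_env_eq power2_norm_eq_inner add_divide_distrib diff_divide_distrib
      times_divide_eq_left mult_1_left
    by linarith
qed

text \<open>The lower and upper bounds squeeze the first-order remainder between \<open>0\<close>
  and \<open>(norm h)\<^sup>2 / (2 * \<gamma>)\<close>, which is \<open>o(norm h)\<close>.\<close>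

lemma GDERIV_moreau_env: "GDERIV (moreau_env \<gamma> \<phi>) x :> (1 / \<gamma>) *\<^sub>R (x - prox \<gamma> \<phi> x)"
  unfolding gderiv_def has_derivative_at
proof (intro conjI)
  let ?M = "moreau_env \<gamma> \<phi>" and ?D = "(1 / \<gamma>) *\<^sub>R (x - prox \<gamma> \<phi> x)"
  show "bounded_linear (\<lambda>h. inner h ?D)"
    by (rule bounded_linear_inner_left)
  have "norm (norm (?M (x + h) - ?M x - inner h ?D) / norm h) \<le> norm h / (2 * \<gamma>)" for h
  proof (cases "h = 0")
    case False
    have "\<bar>?M (x + h) - ?M x - inner h ?D\<bar> \<le> (norm h)\<^sup>2 / (2 * \<gamma>)"
      using moreau_env_upper[of "x + h" x] moreau_env_lower[of x "x + h"] gamma_pos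
      by (simp add: inner_commute abs_le_iff)
    then have "\<bar>?M (x + h) - ?M x - inner h ?D\<bar> / norm h \<le> (norm h)\<^sup>2 / (2 * \<gamma>) / norm h"
      by (intro divide_right_mono) auto
    with False show ?thesis
      by (simp add: power2_eq_square)
  qed simp
  then have "\<forall>\<^sub>F h in at 0. norm (norm (?M (x + h) - ?M x - inner h ?D) / norm h)
      \<le> norm h / (2 * \<gamma>)"
    by (simp only: eventually_True)
  moreover have "((\<lambda>h. norm h / (2 * \<gamma>)) \<longlongrightarrow> 0) (at (0::'a))"
    using gamma_pos by (auto intro!: tendsto_eq_intros)
  ultimately show "((\<lambda>h. norm (?M (x + h) - ?M x - inner h ?D) / norm h) \<longlongrightarrow> 0) (at 0)"
    by (rule Lim_null_comparison)
qed

lemma gradient_moreau_env: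
  "gradient (moreau_env \<gamma> \<phi>) x = (1 / \<gamma>) *\<^sub>R (x - prox \<gamma> \<phi> x)"
  using GDERIV_moreau_env by (rule gradient_eqI)

section \<open>Bounds on the suboptimality by residuals and envelope gaps\<close>

lemma prox_residual_le:
  "(norm (x - prox \<gamma> \<phi> x))\<^sup>2 \<le> 2 * L * \<gamma>\<^sup>2 * (\<phi> (prox \<gamma> \<phi> x) - \<phi> x_star)"
proof -
  have "(norm ((1 / \<gamma>) *\<^sub>R (x - prox \<gamma> \<phi> x)))\<^sup>2 \<le> 2 * L * (\<phi> (prox \<gamma> \<phi> x) - \<phi> x_star)"
    using L_smooth_gradient_bound[OF smooth L_pos star_le, of "prox \<gamma> \<phi> x"]
    by (simp add: gradient_prox)
  then have "(norm (x - prox \<gamma> \<phi> x))\<^sup>2 / \<gamma>\<^sup>2 \<le> 2 * L * (\<phi> (prox \<gamma> \<phi> x) - \<phi> x_star)"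
    by (simp add: power_divide del: scaleR_right_diff_distrib)
  then show ?thesis
    using gamma_pos by (simp add: pos_divide_le_eq mult.assoc mult.commute[of "\<gamma>\<^sup>2"])
qed

lemma inner_prox_residual_ge:
  "(norm (x - prox \<gamma> \<phi> x))\<^sup>2 + \<gamma> * (\<phi> (prox \<gamma> \<phi> x) - \<phi> x_star)
    \<le> inner (x - prox \<gamma> \<phi> x) (x - x_star)"
proof -
  let ?u = "x - prox \<gamma> \<phi> x"
  have "inner ?u (x_star - prox \<gamma> \<phi> x) = inner ?u ?u - inner ?u (x - x_star)"
    by (simp add: inner_diff_right)
  then show ?thesis
    using prox_subgradient[of x x_star] gamma_pos
    by (simp only: power2_norm_eq_inner) (simp add: field_simps)
qed

lemma value_le_prox_value:
  "\<phi> x \<le> \<phi> (prox \<gamma> \<phi> x) + (1 / \<gamma> + L / 2) * (norm (x - prox \<gamma> \<phi> x))\<^sup>2"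
proof -
  let ?p = "prox \<gamma> \<phi> x"
  have "\<phi> x - \<phi> ?p - inner (gradient \<phi> ?p) (x - ?p) \<le> L / 2 * (norm (x - ?p))\<^sup>2"
    using smooth unfolding L_smooth_def by blast
  then show ?thesis
    by (simp add: gradient_prox dot_square_norm distrib_right del: inner_diff_left inner_diff_right)
qed

lemma inner_prox_residual_ge_moreau_env:
  "\<gamma> * (moreau_env \<gamma> \<phi> x - \<phi> x_star) \<le> inner (x - prox \<gamma> \<phi> x) (x - x_star)"
proof -
  have "\<gamma> * (moreau_env \<gamma> \<phi> x - \<phi> x_star)
      = (norm (x - prox \<gamma> \<phi> x))\<^sup>2 / 2 + \<gamma> * (\<phi> (prox \<gamma> \<phi> x) - \<phi> x_star)"
    using gamma_pos by (simp add: moreau_env_eq field_simps)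
  then show ?thesis
    using inner_prox_residual_ge[of x] zero_le_power2[of "norm (x - prox \<gamma> \<phi> x)"] by linarith
qed

text \<open>Of the term \<open>t / \<gamma>\<close> in the bound on \<open>\<phi> x\<close>, one
  half is traded for \<open>L * \<gamma> * d\<close> by the residual bound. What results is exactly
  the expanded right-hand side.\<close>

lemma gap_le_moreau_gap:
  "\<phi> x - \<phi> x_star \<le> (1 + \<gamma> * L) * (moreau_env \<gamma> \<phi> x - \<phi> x_star)"
proof -
  define t where "t = (norm (x - prox \<gamma> \<phi> x))\<^sup>2"
  define d where "d = \<phi> (prox \<gamma> \<phi> x) - \<phi> x_star"
  have "t / (2 * \<gamma>) \<le> L * \<gamma> * d"
    using prox_residual_le[of x] gamma_pos
    by (simp add: t_def d_def field_simps power2_eq_square)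
  moreover have "(1 + \<gamma> * L) * (d + t / (2 * \<gamma>)) = d + L * \<gamma> * d + t / (2 * \<gamma>) + L / 2 * t"
    using gamma_pos by (simp add: field_simps)
  moreover have "t / \<gamma> = t / (2 * \<gamma>) + t / (2 * \<gamma>)"
    using gamma_pos by (simp add: field_simps)
  moreover have "\<phi> x - \<phi> x_star \<le> d + (t / \<gamma> + L / 2 * t)"
    using value_le_prox_value[of x] by (simp add: t_def d_def algebra_simps)
  ultimately have "\<phi> x - \<phi> x_star \<le> (1 + \<gamma> * L) * (d + t / (2 * \<gamma>))"
    by linarith
  then show ?thesis
    by (simp add: moreau_env_eq t_def d_def algebra_simps)
qed

lemma gap_le_prox_decrease:
  "\<phi> x - \<phi> x_star \<le> (1 + \<gamma> * L) / (2 + \<gamma> * L) * (1 / \<gamma> + L) *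
    (2 * inner (x - prox \<gamma> \<phi> x) (x - x_star) - (norm (x - prox \<gamma> \<phi> x))\<^sup>2)"
proof -
  define t where "t = (norm (x - prox \<gamma> \<phi> x))\<^sup>2"
  define d where "d = \<gamma> * (\<phi> (prox \<gamma> \<phi> x) - \<phi> x_star)"
  \<comment> \<open>Multiplying the gap by \<open>\<gamma>\<close> leaves \<open>l\<close> as the
    only parameter. The bracket of the claim is at least \<open>t + 2 * d\<close>, so an inequality
    in \<open>l\<close>, \<open>t\<close> and \<open>d\<close> remains.\<close>
  define l where "l = \<gamma> * L"
  have l: "l > 0"
    using gamma_pos L_pos by (simp add: l_def)
  have t: "0 \<le> t" "t \<le> 2 * l * d"
    using prox_residual_le[of x] by (auto simp: t_def d_def l_def power2_eq_square mult_ac)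
  then have d: "0 \<le> l * d"
    by linarith
  have "\<gamma> * (\<phi> x - \<phi> x_star) \<le> d + (1 + l / 2) * t"
  proof -
    have "\<gamma> * (1 / \<gamma> + L / 2) = 1 + l / 2"
      using gamma_pos by (simp add: l_def field_simps)
    then have "\<gamma> * ((1 / \<gamma> + L / 2) * t) = (1 + l / 2) * t"
      by (metis mult.assoc)
    then show ?thesis
      using mult_left_mono[OF value_le_prox_value[of x], of \<gamma>] gamma_pos
      unfolding d_def t_def[symmetric] right_diff_distrib distrib_left[of \<gamma>] by linarith
  qed
  then have "(2 + l) * (\<gamma> * (\<phi> x - \<phi> x_star)) \<le> (2 + l) * (d + (1 + l / 2) * t)"
    using l by (intro mult_left_mono) auto
  also have "\<dots> \<le> (1 + l)\<^sup>2 * (t + 2 * d)"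
  proof -
    \<comment> \<open>The only negative term, \<open>- t\<close>, is paired with
      \<open>2 * l * d\<close>, which dominates it by the residual bound.\<close>
    have "(1 + l)\<^sup>2 * (t + 2 * d) - (2 + l) * (d + (1 + l / 2) * t)
        = t * l\<^sup>2 / 2 + (2 * l * d - t) + l * d + 2 * l * (l * d)"
      by (simp add: power2_eq_square field_simps)
    moreover have "0 \<le> t * l\<^sup>2 / 2" "0 \<le> 2 * l * (l * d)"
      using l t d by auto
    ultimately show ?thesis
      using t d by linarith
  qed
  also have "\<dots> \<le> (1 + l)\<^sup>2 * (2 * inner (x - prox \<gamma> \<phi> x) (x - x_star) - t)"
    using inner_prox_residual_ge[of x] by (intro mult_left_mono) (auto simp: t_def d_def)
  finally have "\<phi> x - \<phi> x_star \<le>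
      (1 + l)\<^sup>2 * (2 * inner (x - prox \<gamma> \<phi> x) (x - x_star) - t) / (\<gamma> * (2 + l))"
    using l gamma_pos by (subst pos_le_divide_eq) (simp_all add: mult_ac)
  also have "\<dots> = (1 + l)\<^sup>2 / (\<gamma> * (2 + l)) *
      (2 * inner (x - prox \<gamma> \<phi> x) (x - x_star) - t)"
    by simp
  also have "(1 + l)\<^sup>2 / (\<gamma> * (2 + l)) = (1 + l) / (2 + l) * (1 / \<gamma> + L)"
  proof -
    have "1 / \<gamma> + L = (1 + l) / \<gamma>"
      using gamma_pos by (simp add: l_def field_simps)
    then show ?thesis
      by (simp add: power2_eq_square mult_ac)
  qed
  finally show ?thesis
    by (simp add: l_def t_def)
qed

end

section \<open>Averages and the telescoping argument\<close>

lemma avg_mono: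
  fixes v w :: "nat \<Rightarrow> real"
  assumes "\<And>i. i \<in> {1..n} \<Longrightarrow> v i \<le> w i"
  shows "avg n v \<le> avg n w"
  unfolding avg_def real_scaleR_def using assms by (intro mult_left_mono sum_mono) auto

lemma avg_cong: "(\<And>i. i \<in> {1..n} \<Longrightarrow> v i = w i) \<Longrightarrow> avg n v = avg n w"
  by (simp add: avg_def)

lemma avg_diff: "avg n (\<lambda>i. v i - w i) = avg n v - avg n w"
  by (simp add: avg_def sum_subtractf scaleR_diff_right)

lemma avg_scaleR: "avg n (\<lambda>i. c *\<^sub>R v i) = c *\<^sub>R avg n v"
  by (simp add: avg_def scaleR_sum_right mult.commute)

lemma avg_mult: "avg n (\<lambda>i. c * v i) = c * avg n v" for c :: real
  using avg_scaleR[of n c v] by simp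

lemma avg_const: "n \<ge> 1 \<Longrightarrow> avg n (\<lambda>_. c) = c"
  by (simp add: avg_def sum_constant_scaleR)

lemma avg_inner: "avg n (\<lambda>i. inner (v i) y) = inner (avg n v) y"
  by (simp add: avg_def inner_sum_left)

text \<open>The difference of the two sides is the variance of \<open>v\<close>.\<close>

lemma norm_avg_power2_le:
  fixes v :: "nat \<Rightarrow> 'a::real_inner"
  assumes "n \<ge> 1"
  shows "(norm (avg n v))\<^sup>2 \<le> avg n (\<lambda>i. (norm (v i))\<^sup>2)"
proof -
  let ?m = "avg n v"
  \<comment> \<open>Expanded form of \<open>0 \<le> (norm (v i - ?m))\<^sup>2\<close>; on average
    the left-hand side becomes \<open>(norm ?m)\<^sup>2\<close>.\<close>
  have "2 * inner (v i) ?m - (norm ?m)\<^sup>2 \<le> (norm (v i))\<^sup>2" for i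
    using inner_ge_zero[of "v i - ?m"]
    by (simp add: power2_norm_eq_inner inner_diff_left inner_diff_right inner_commute)
  then have "avg n (\<lambda>i. 2 * inner (v i) ?m - (norm ?m)\<^sup>2) \<le> avg n (\<lambda>i. (norm (v i))\<^sup>2)"
    by (intro avg_mono)
  then show ?thesis
    using assms by (simp add: avg_diff avg_mult avg_inner avg_const dot_square_norm)
qed

text \<open>Serves both step sizes: sampling proportionally to \<open>a\<close> makes the expected
  gap a weighted sum over \<open>k\<close>, in which the distances to \<open>z\<close> telescope and
  the last one is dropped.\<close>

lemma expectation_random_iterate_le:
  fixes x :: "nat \<Rightarrow> 'a::real_inner" and g :: "'a \<Rightarrow> real"
  assumes "K \<ge> 1" "\<And>k. k < K \<Longrightarrow> a k > 0" "C \<ge> 0"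
    and step: "\<And>k. k < K \<Longrightarrow>
      a k * (g (x k) - m) \<le> C * ((norm (x k - z))\<^sup>2 - (norm (x (Suc k) - z))\<^sup>2)"
  shows "measure_pmf.expectation (random_iterate x a K) g - m
    \<le> C * ((norm (x 0 - z))\<^sup>2 / (\<Sum>k<K. a k))"
proof -
  let ?S = "\<Sum>k<K. a k"
  have S: "?S > 0"
    using assms by (intro sum_pos) (auto simp: lessThan_empty_iff)
  have "(\<Sum>k<K. a k * (g (x k) - m))
      \<le> (\<Sum>k<K. C * ((norm (x k - z))\<^sup>2 - (norm (x (Suc k) - z))\<^sup>2))"
    using step by (intro sum_mono) auto
  also have "\<dots> = C * ((norm (x 0 - z))\<^sup>2 - (norm (x K - z))\<^sup>2)"
    unfolding sum_distrib_left[symmetric] by (subst sum_lessThan_telescope') rule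
  also have "\<dots> \<le> C * (norm (x 0 - z))\<^sup>2"
    using \<open>C \<ge> 0\<close> by (intro mult_left_mono) auto
  finally have "(\<Sum>k<K. a k * (g (x k) - m)) / ?S \<le> C * (norm (x 0 - z))\<^sup>2 / ?S"
    using S by (intro divide_right_mono) auto
  moreover have "(\<Sum>k<K. a k * (g (x k) - m)) / ?S
      = (\<Sum>k<K. a k / ?S * g (x k)) - m"
  proof -
    have "(\<Sum>k<K. a k * (g (x k) - m)) = (\<Sum>k<K. a k * g (x k)) - ?S * m"
      by (simp add: right_diff_distrib sum_subtractf sum_distrib_right)
    then show ?thesis
      using S by (simp add: diff_divide_distrib sum_divide_distrib)
  qed
  ultimately show ?thesis
    using expectation_random_iterate[of K a x g, OF assms(1,2)] by simp
qed

text \<open>The premises on the denominators exclude the value \<open>0\<close> that division by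
  zero would give a step size, against the asserted lower bounds.\<close>

theorem theorem2:
  fixes f :: "nat \<Rightarrow> real ^ 'd \<Rightarrow> real" and L :: "nat \<Rightarrow> real" and n K :: nat
    and \<gamma> L\<gamma> Lmax :: real and x_star :: "real ^ 'd"
    and x :: "nat \<Rightarrow> real ^ 'd" and \<alpha> :: "nat \<Rightarrow> real"
    and F M :: "real ^ 'd \<Rightarrow> real"
  assumes "n \<ge> 1" and "K \<ge> 1" and "\<gamma> > 0"
    and "\<And>i y. i \<in> {1..n} \<Longrightarrow> f i differentiable (at y)"
    and "\<And>i. i \<in> {1..n} \<Longrightarrow> convex_on UNIV (f i)"
    and "\<And>i. i \<in> {1..n} \<Longrightarrow> L i > 0"
    and "\<And>i. i \<in> {1..n} \<Longrightarrow> L_smooth (L i) (f i)"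
    and "Lmax = Max (L ` {1..n})"
    and "F = (\<lambda>y. avg n (\<lambda>i. f i y))"
    and "M = (\<lambda>y. avg n (\<lambda>i. moreau_env \<gamma> (f i) y))"
    and "\<And>i. i \<in> {1..n} \<Longrightarrow> gradient (f i) x_star = 0"
    and "L\<gamma> > 0" and "L_smooth L\<gamma> M"
    and "\<And>k. k < K \<Longrightarrow> x (Suc k) = x k + \<alpha> k *\<^sub>R (avg n (\<lambda>i. prox \<gamma> (f i) (x k)) - x k)"
  shows "((\<forall>k<K. (norm (avg n (\<lambda>i. x k - prox \<gamma> (f i) (x k))))\<^sup>2 \<noteq> 0 \<and>
        \<alpha> k = alpha_GraDS n \<gamma> f (x k)) \<longrightarrow>
      (\<forall>k<K. alpha_GraDS n \<gamma> f (x k) \<ge> 1) \<and>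
      measure_pmf.expectation (random_iterate x \<alpha> K) F - (INF y. F y)
        \<le> (1 + \<gamma> * Lmax) / (2 + \<gamma> * Lmax) * (1 / \<gamma> + Lmax) *
          ((norm (x 0 - x_star))\<^sup>2 / (\<Sum>k<K. alpha_GraDS n \<gamma> f (x k)))) \<and>
    ((\<forall>k<K. \<gamma> * (norm (avg n (\<lambda>i. gradient (moreau_env \<gamma> (f i)) (x k))))\<^sup>2 \<noteq> 0 \<and>
        \<alpha> k = alpha_StoPS n \<gamma> f (x k)) \<longrightarrow>
      (\<forall>k<K. alpha_StoPS n \<gamma> f (x k) \<ge> 1 / (2 * \<gamma> * L\<gamma>)) \<and>
      measure_pmf.expectation (random_iterate x \<alpha> K) F - (INF y. F y)
        \<le> (1 / \<gamma> + Lmax) * ((norm (x 0 - x_star))\<^sup>2 / (\<Sum>k<K. alpha_StoPS n \<gamma> f (x k))))"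
proof -
  note n = assms(1) and K = assms(2) and gamma = assms(3)
  note Lmax = assms(8) and F = assms(9) and M = assms(10) and Lg = assms(12,13) and iter = assms(14)
  define u where "u i y = y - prox \<gamma> (f i) y" for i y
  \<comment> \<open>Average envelope gap: \<open>f i x_star\<close> is the infimum of the envelope
    of \<open>f i\<close>.\<close>
  define S where "S y = avg n (\<lambda>i. moreau_env \<gamma> (f i) y - f i x_star)" for y
  have L_le: "L i \<le> Lmax" if "i \<in> {1..n}" for i
    using that by (auto simp: Lmax)
  have Lmax_pos: "Lmax > 0"
    using L_le[of 1] assms(6)[of 1] n by auto
  have prox: "smooth_convex_prox (f i) Lmax \<gamma> x_star" if "i \<in> {1..n}" for i
    using that assms(5,11) gamma Lmax_pos L_smooth_mono[OF assms(7) L_le]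
    by unfold_locales auto
  have F_ge: "F x_star \<le> F y" for y
    unfolding F by (rule avg_mono) (rule smooth_convex_prox.star_le[OF prox])
  have INF_F: "(INF y. F y) = F x_star"
    using F_ge by (intro cInf_eq_minimum) auto
  have S_eq: "S y = M y - F x_star" for y
    by (simp add: S_def M F avg_diff)
  have gap: "F y - F x_star = avg n (\<lambda>i. f i y - f i x_star)" for y
    by (simp add: F avg_diff)
  have inner_ge: "\<gamma> * S y \<le> inner (avg n (\<lambda>i. u i y)) (y - x_star)" for y
    unfolding S_def avg_mult[symmetric] avg_inner[symmetric] u_def
    by (rule avg_mono) (rule smooth_convex_prox.inner_prox_residual_ge_moreau_env[OF prox])
  have gap_S: "F y - F x_star \<le> (1 + \<gamma> * Lmax) * S y" for y
    unfolding gap S_def avg_mult[symmetric]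
    by (rule avg_mono) (rule smooth_convex_prox.gap_le_moreau_gap[OF prox])
  define C where "C = (1 + \<gamma> * Lmax) / (2 + \<gamma> * Lmax) * (1 / \<gamma> + Lmax)"
  have C: "C \<ge> 0"
    using gamma Lmax_pos by (simp add: C_def)
  have gap_C: "F y - F x_star \<le>
      C * (2 * inner (avg n (\<lambda>i. u i y)) (y - x_star) - avg n (\<lambda>i. (norm (u i y))\<^sup>2))" for y
    unfolding gap avg_mult[symmetric] avg_inner[symmetric] avg_diff[symmetric] u_def C_def
    by (rule avg_mono) (rule smooth_convex_prox.gap_le_prox_decrease[OF prox])
  \<comment> \<open>One iteration subtracts \<open>\<alpha> k\<close> times the average residual;
    this is the expanded square.\<close>
  have dist: "(norm (x k - x_star))\<^sup>2 - (norm (x (Suc k) - x_star))\<^sup>2 =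
      \<alpha> k * (2 * inner (avg n (\<lambda>i. u i (x k))) (x k - x_star)
        - \<alpha> k * (norm (avg n (\<lambda>i. u i (x k))))\<^sup>2)" if "k < K" for k
  proof -
    let ?B = "avg n (\<lambda>i. u i (x k))"
    have "?B = x k - avg n (\<lambda>i. prox \<gamma> (f i) (x k))"
      using n by (simp add: u_def avg_diff avg_const)
    then have "x (Suc k) - x_star = (x k - x_star) - \<alpha> k *\<^sub>R ?B"
      using iter[OF that] by (simp only:) (simp add: algebra_simps)
    moreover have "(norm (v - c *\<^sub>R w))\<^sup>2 = (norm v)\<^sup>2 - c * (2 * inner w v - c * (norm w)\<^sup>2)"
      for v w :: "real ^ 'd" and c
      by (simp add: power2_norm_eq_inner inner_diff_left inner_diff_right inner_commute algebra_simps)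
    ultimately show ?thesis
      by (simp only:)
  qed
  have grad: "avg n (\<lambda>i. gradient (moreau_env \<gamma> (f i)) y) = (1 / \<gamma>) *\<^sub>R avg n (\<lambda>i. u i y)" for y
    unfolding avg_scaleR[symmetric] u_def
    by (rule avg_cong) (rule smooth_convex_prox.gradient_moreau_env[OF prox])
  have StoPS: "alpha_StoPS n \<gamma> f y = S y /
      (\<gamma> * (norm (avg n (\<lambda>i. gradient (moreau_env \<gamma> (f i)) y)))\<^sup>2)" for y
  proof -
    have "avg n (\<lambda>i. moreau_env \<gamma> (f i) y - (INF y. moreau_env \<gamma> (f i) y)) = S y"
      unfolding S_def by (rule avg_cong) (simp add: smooth_convex_prox.INF_moreau_env[OF prox])
    then show ?thesis
      by (simp add: alpha_StoPS_def)
  qed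
  \<comment> \<open>Makes the smoothness of \<open>M\<close> speak about the vector in the
    denominator of \<open>alpha_StoPS\<close>.\<close>
  have grad_M: "gradient M y = avg n (\<lambda>i. gradient (moreau_env \<gamma> (f i)) y)" for y
    unfolding M grad avg_scaleR[symmetric] u_def
    by (intro gradient_eqI GDERIV_avg) (rule smooth_convex_prox.GDERIV_moreau_env[OF prox])
  have F_le_M: "F x_star \<le> M y" for y
    unfolding F M by (rule avg_mono) (rule smooth_convex_prox.star_le_moreau_env[OF prox])
  show ?thesis
  proof (intro conjI impI)
    assume A: "\<forall>k<K. (norm (avg n (\<lambda>i. x k - prox \<gamma> (f i) (x k))))\<^sup>2 \<noteq> 0 \<and>
      \<alpha> k = alpha_GraDS n \<gamma> f (x k)"
    show ge1: "\<forall>k<K. alpha_GraDS n \<gamma> f (x k) \<ge> 1"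
      using A norm_avg_power2_le[OF n] by (auto simp: alpha_GraDS_def le_divide_eq)
    have "measure_pmf.expectation (random_iterate x \<alpha> K) F - F x_star
        \<le> C * ((norm (x 0 - x_star))\<^sup>2 / (\<Sum>k<K. \<alpha> k))"
    proof (rule expectation_random_iterate_le[OF K _ C])
      fix k assume k: "k < K"
      let ?B = "avg n (\<lambda>i. u i (x k))"
      show "\<alpha> k > 0"
        using A ge1 k by fastforce
      \<comment> \<open>This identity turns the bracket in \<open>dist\<close> into the one in
        \<open>gap_C\<close>.\<close>
      have "\<alpha> k * (norm ?B)\<^sup>2 = avg n (\<lambda>i. (norm (u i (x k)))\<^sup>2)"
        using A k by (auto simp: alpha_GraDS_def u_def)
      then show "\<alpha> k * (F (x k) - F x_star)
          \<le> C * ((norm (x k - x_star))\<^sup>2 - (norm (x (Suc k) - x_star))\<^sup>2)"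
        using mult_left_mono[OF gap_C[of "x k"], of "\<alpha> k"] \<open>\<alpha> k > 0\<close>
        by (simp add: dist[OF k] mult.left_commute)
    qed
    then show "measure_pmf.expectation (random_iterate x \<alpha> K) F - (INF y. F y)
        \<le> (1 + \<gamma> * Lmax) / (2 + \<gamma> * Lmax) * (1 / \<gamma> + Lmax) *
          ((norm (x 0 - x_star))\<^sup>2 / (\<Sum>k<K. alpha_GraDS n \<gamma> f (x k)))"
      using A by (simp add: INF_F C_def)
  next
    assume A: "\<forall>k<K. \<gamma> * (norm (avg n (\<lambda>i. gradient (moreau_env \<gamma> (f i)) (x k))))\<^sup>2 \<noteq> 0 \<and>
      \<alpha> k = alpha_StoPS n \<gamma> f (x k)"
    show ge: "\<forall>k<K. alpha_StoPS n \<gamma> f (x k) \<ge> 1 / (2 * \<gamma> * L\<gamma>)"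
    proof (intro allI impI)
      fix k assume "k < K"
      let ?G = "avg n (\<lambda>i. gradient (moreau_env \<gamma> (f i)) (x k))"
      \<comment> \<open>The gradient bound for \<open>M\<close> with lower bound
        \<open>F x_star\<close>, since \<open>S\<close> is \<open>M\<close> minus that
        value.\<close>
      have "(norm ?G)\<^sup>2 \<le> 2 * L\<gamma> * S (x k)"
        using L_smooth_gradient_bound[OF Lg(2,1) F_le_M, of "x k"] by (simp add: grad_M S_eq)
      moreover have "(norm ?G)\<^sup>2 > 0"
        using A \<open>k < K\<close> by auto
      ultimately show "alpha_StoPS n \<gamma> f (x k) \<ge> 1 / (2 * \<gamma> * L\<gamma>)"
        using gamma Lg(1) by (simp add: StoPS field_simps)
    qed
    have "measure_pmf.expectation (random_iterate x \<alpha> K) F - F x_star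
        \<le> (1 / \<gamma> + Lmax) * ((norm (x 0 - x_star))\<^sup>2 / (\<Sum>k<K. \<alpha> k))"
    proof (rule expectation_random_iterate_le[OF K])
      show "1 / \<gamma> + Lmax \<ge> 0"
        using gamma Lmax_pos by simp
      fix k assume k: "k < K"
      let ?B = "avg n (\<lambda>i. u i (x k))"
      have "0 < 1 / (2 * \<gamma> * L\<gamma>)"
        using gamma Lg(1) by simp
      with ge A k show pos: "\<alpha> k > 0"
        by (metis order_less_le_trans)
      \<comment> \<open>The averaged envelope gradient is \<open>?B\<close> divided by
        \<open>\<gamma>\<close>, which moves the factor \<open>\<gamma>\<close> into the
        numerator.\<close>
      have "\<alpha> k = \<gamma> * S (x k) / (norm ?B)\<^sup>2" "norm ?B \<noteq> 0"
        using A k gamma by (auto simp: StoPS grad power_divide power2_eq_square)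
      then have "\<alpha> k * (norm ?B)\<^sup>2 = \<gamma> * S (x k)"
        by simp
      \<comment> \<open>Of the two copies of \<open>inner_ge\<close>, one absorbs
        \<open>\<alpha> k * (norm ?B)\<^sup>2\<close> and the other is left over.\<close>
      then have "\<gamma> * S (x k) \<le> 2 * inner ?B (x k - x_star) - \<alpha> k * (norm ?B)\<^sup>2"
        using inner_ge[of "x k"] by simp
      then have "(1 / \<gamma> + Lmax) * (\<gamma> * S (x k))
          \<le> (1 / \<gamma> + Lmax) * (2 * inner ?B (x k - x_star) - \<alpha> k * (norm ?B)\<^sup>2)"
        using gamma Lmax_pos by (intro mult_left_mono) auto
      moreover have "(1 / \<gamma> + Lmax) * (\<gamma> * S (x k)) = (1 + \<gamma> * Lmax) * S (x k)"
        using gamma by (simp add: field_simps)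
      ultimately have "F (x k) - F x_star
          \<le> (1 / \<gamma> + Lmax) * (2 * inner ?B (x k - x_star) - \<alpha> k * (norm ?B)\<^sup>2)"
        using gap_S[of "x k"] by linarith
      then show "\<alpha> k * (F (x k) - F x_star)
          \<le> (1 / \<gamma> + Lmax) * ((norm (x k - x_star))\<^sup>2 - (norm (x (Suc k) - x_star))\<^sup>2)"
        using mult_left_mono[of "F (x k) - F x_star" _ "\<alpha> k"] pos
        by (simp add: dist[OF k] mult.left_commute)
    qed
    then show "measure_pmf.expectation (random_iterate x \<alpha> K) F - (INF y. F y)
        \<le> (1 / \<gamma> + Lmax) * ((norm (x 0 - x_star))\<^sup>2 / (\<Sum>k<K. alpha_StoPS n \<gamma> f (x k)))"
      using A by (simp add: INF_F)
  qed
qed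

end
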